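(* Let $k$ be a field, $\lambda\in k$, $C$ a coalgebra over $k$, $M$ a left $C$-comodule, and $T:M\to M$ a (left) $C$-colinear map. Then the following are equivalent. (1) $(M,T)$ is a generic Rota-Baxter paired $C$-comodule of weight $\lambda$. (2) There is a linear operator $P:C\to C$ such that $(M,P,T)$ is a Rota-Baxter paired $C$-comodule of weight $\lambda$. (3) $T$ is quasi-idempotent of weight $\lambda$.
   Context: All spaces, maps and tensor products are over $k$. Let $C$ be a (coassociative, counital) coalgebra and $M$ a left $C$-comodule with coaction $\rho:M\to C\otimes M$. For linear maps $P:C\to C$ and $T:M\to M$, the triple $(M,P,T)$ is a Rota-Baxter paired (left) $C$-comodule of weight $\lambda$ if $$(P\otimes T)\rho=(P\otimes \mathrm{id})\rho T+(\mathrm{id}\otimes T)\rho T+\lambda\rho T.$$ Given a linear map $T:M\to M$, $(M,T)$ is a generic Rota-Baxter paired $C$-comodule of weight $\lambda$ if $(M,P,T)$ is a Rota-Baxter paired $C$-comodule of weight $\lambda$ for every linear map $P:C\to C$. A linear map $T:M\to M$ is quasi-idempotent of weight $\lambda$ if $T^2=-\lambda T$. $T$ is $C$-colinear if $\rho T=(\mathrm{id}\otimes T)\rho$. *)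

theory Defs
  imports "HOL-Algebra.Module" "HOL-Algebra.AbelCoset"
begin

section \<open>Tensor products of vector spaces\<close>

text \<open>Vector spaces over a field \<open>K\<close> are modules in the sense of the locale
  \<^locale>\<open>module\<close>.  The \<^term>\<open>mult\<close> and \<^term>\<open>one\<close> components that the module record
  inherits from rings play no role.\<close>

definition linear_maps ::
    "[('k, 'x) ring_scheme, ('k, 'v, 'y) module_scheme, ('k, 'w, 'z) module_scheme] \<Rightarrow> ('v \<Rightarrow> 'w) set"
  where "linear_maps K V W =
    {f \<in> carrier V \<rightarrow> carrier W.
      (\<forall>u\<in>carrier V. \<forall>v\<in>carrier V. f (u \<oplus>\<^bsub>V\<^esub> v) = f u \<oplus>\<^bsub>W\<^esub> f v) \<and>
      (\<forall>a\<in>carrier K. \<forall>v\<in>carrier V. f (a \<odot>\<^bsub>V\<^esub> v) = a \<odot>\<^bsub>W\<^esub> f v)}"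

definition field_module :: "('k, 'x) ring_scheme \<Rightarrow> ('k, 'k) module"
  where "field_module K =
    \<lparr>carrier = carrier K, mult = mult K, one = \<one>\<^bsub>K\<^esub>, zero = \<zero>\<^bsub>K\<^esub>, add = add K, smult = mult K\<rparr>"

definition free_module :: "[('k, 'x) ring_scheme, 'i set] \<Rightarrow> ('k, 'i \<Rightarrow> 'k) module"
  where "free_module K I =
    \<lparr>carrier = {x. (\<forall>i. x i \<in> carrier K) \<and> finite {i. x i \<noteq> \<zero>\<^bsub>K\<^esub>} \<and> {i. x i \<noteq> \<zero>\<^bsub>K\<^esub>} \<subseteq> I},
     mult = undefined, one = undefined,
     zero = (\<lambda>i. \<zero>\<^bsub>K\<^esub>), add = (\<lambda>x y i. x i \<oplus>\<^bsub>K\<^esub> y i), smult = (\<lambda>a x i. a \<otimes>\<^bsub>K\<^esub> x i)\<rparr>"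

definition free_basis :: "[('k, 'x) ring_scheme, 'i] \<Rightarrow> 'i \<Rightarrow> 'k"
  where "free_basis K i = (\<lambda>j. if j = i then \<one>\<^bsub>K\<^esub> else \<zero>\<^bsub>K\<^esub>)"

text \<open>As for quotient rings, scalar multiplication on cosets is the union of the cosets of the
  products of representatives; the pointwise image would be wrong for the scalar zero.\<close>

definition quotient_module :: "[('k, 'v, 'y) module_scheme, 'v set] \<Rightarrow> ('k, 'v set) module"
  where "quotient_module V H =
    \<lparr>carrier = a_rcosets\<^bsub>V\<^esub> H, mult = undefined, one = undefined,
     zero = H, add = set_add V, smult = (\<lambda>a X. \<Union>x\<in>X. H +>\<^bsub>V\<^esub> (a \<odot>\<^bsub>V\<^esub> x))\<rparr>"

definition tensor_relations ::
    "[('k, 'x) ring_scheme, ('k, 'v, 'y) module_scheme, ('k, 'w, 'z) module_scheme] \<Rightarrow> ('v \<times> 'w \<Rightarrow> 'k) set"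
  where "tensor_relations K V W =
    (let F = free_module K (carrier V \<times> carrier W); d = (\<lambda>v w. free_basis K (v, w))
     in \<Inter>{H. submodule H K F \<and>
       {d (u \<oplus>\<^bsub>V\<^esub> v) w \<ominus>\<^bsub>F\<^esub> (d u w \<oplus>\<^bsub>F\<^esub> d v w) | u v w.
          u \<in> carrier V \<and> v \<in> carrier V \<and> w \<in> carrier W} \<union>
       {d v (w \<oplus>\<^bsub>W\<^esub> z) \<ominus>\<^bsub>F\<^esub> (d v w \<oplus>\<^bsub>F\<^esub> d v z) | v w z.
          v \<in> carrier V \<and> w \<in> carrier W \<and> z \<in> carrier W} \<union>
       {d (a \<odot>\<^bsub>V\<^esub> v) w \<ominus>\<^bsub>F\<^esub> a \<odot>\<^bsub>F\<^esub> d v w | a v w.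
          a \<in> carrier K \<and> v \<in> carrier V \<and> w \<in> carrier W} \<union>
       {d v (a \<odot>\<^bsub>W\<^esub> w) \<ominus>\<^bsub>F\<^esub> a \<odot>\<^bsub>F\<^esub> d v w | a v w.
          a \<in> carrier K \<and> v \<in> carrier V \<and> w \<in> carrier W} \<subseteq> H})"

definition tensor_product ::
    "[('k, 'x) ring_scheme, ('k, 'v, 'y) module_scheme, ('k, 'w, 'z) module_scheme]
      \<Rightarrow> ('k, ('v \<times> 'w \<Rightarrow> 'k) set) module"
  where "tensor_product K V W =
    quotient_module (free_module K (carrier V \<times> carrier W)) (tensor_relations K V W)"

definition pure_tensor ::
    "[('k, 'x) ring_scheme, ('k, 'v, 'y) module_scheme, ('k, 'w, 'z) module_scheme, 'v, 'w]
      \<Rightarrow> ('v \<times> 'w \<Rightarrow> 'k) set"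
  where "pure_tensor K V W v w =
    tensor_relations K V W +>\<^bsub>free_module K (carrier V \<times> carrier W)\<^esub> free_basis K (v, w)"

text \<open>\<open>tensor_lift K U \<beta>\<close> is the linear map into \<open>U\<close> induced by the bilinear map \<open>\<beta>\<close>: it sends
  the class of the formal sum of the terms \<open>x (v, w) \<cdot> (v, w)\<close> to the sum of the
  \<open>x (v, w) \<odot> \<beta> v w\<close>.  For bilinear \<open>\<beta>\<close> all representatives of a class yield the same value.\<close>

definition tensor_lift ::
    "[('k, 'x) ring_scheme, ('k, 'u, 'y) module_scheme, 'v \<Rightarrow> 'w \<Rightarrow> 'u, ('v \<times> 'w \<Rightarrow> 'k) set] \<Rightarrow> 'u"
  where "tensor_lift K U \<beta> X =
    the_elem ((\<lambda>x. \<Oplus>\<^bsub>U\<^esub>p\<in>{p. x p \<noteq> \<zero>\<^bsub>K\<^esub>}. x p \<odot>\<^bsub>U\<^esub> \<beta> (fst p) (snd p)) ` X)"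

text \<open>In \<open>tensor_map K V W f g\<close>, the spaces \<open>V\<close> and \<open>W\<close> are the codomains of \<open>f\<close> and \<open>g\<close>.\<close>

definition tensor_map ::
    "[('k, 'x) ring_scheme, ('k, 'v, 'y) module_scheme, ('k, 'w, 'z) module_scheme,
      'a \<Rightarrow> 'v, 'b \<Rightarrow> 'w, ('a \<times> 'b \<Rightarrow> 'k) set] \<Rightarrow> ('v \<times> 'w \<Rightarrow> 'k) set"
  where "tensor_map K V W f g =
    tensor_lift K (tensor_product K V W) (\<lambda>a b. pure_tensor K V W (f a) (g b))"

text \<open>The canonical map \<open>(U \<otimes> V) \<otimes> W \<rightarrow> U \<otimes> (V \<otimes> W)\<close>.\<close>

definition tensor_assoc ::
    "[('k, 'x) ring_scheme, ('k, 'u, 'p) module_scheme, ('k, 'v, 'q) module_scheme,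
      ('k, 'w, 'r) module_scheme, (('u \<times> 'v \<Rightarrow> 'k) set \<times> 'w \<Rightarrow> 'k) set]
      \<Rightarrow> ('u \<times> ('v \<times> 'w \<Rightarrow> 'k) set \<Rightarrow> 'k) set"
  where "tensor_assoc K U V W =
    (let VW = tensor_product K V W; T = tensor_product K U VW
     in tensor_lift K T (\<lambda>t w. tensor_lift K T (\<lambda>u v. pure_tensor K U VW u (pure_tensor K V W v w)) t))"

text \<open>The canonical maps \<open>k \<otimes> V \<rightarrow> V\<close> and \<open>V \<otimes> k \<rightarrow> V\<close>.\<close>

definition tensor_lunit ::
    "[('k, 'x) ring_scheme, ('k, 'v, 'y) module_scheme, ('k \<times> 'v \<Rightarrow> 'k) set] \<Rightarrow> 'v"
  where "tensor_lunit K V = tensor_lift K V (\<lambda>a v. a \<odot>\<^bsub>V\<^esub> v)"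

definition tensor_runit ::
    "[('k, 'x) ring_scheme, ('k, 'v, 'y) module_scheme, ('v \<times> 'k \<Rightarrow> 'k) set] \<Rightarrow> 'v"
  where "tensor_runit K V = tensor_lift K V (\<lambda>v a. a \<odot>\<^bsub>V\<^esub> v)"


section \<open>Coalgebras and comodules\<close>

locale coalgebra = K?: field K + C?: module K C for K (structure) and C (structure) +
  fixes \<Delta> \<epsilon>
  assumes comult_linear: "\<Delta> \<in> linear_maps K C (tensor_product K C C)"
    and counit_linear: "\<epsilon> \<in> linear_maps K C (field_module K)"
    and coassoc: "c \<in> carrier C \<Longrightarrow>
      tensor_assoc K C C C (tensor_map K (tensor_product K C C) C \<Delta> id (\<Delta> c)) =
      tensor_map K C (tensor_product K C C) id \<Delta> (\<Delta> c)"
    and counit_left: "c \<in> carrier C \<Longrightarrow>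
      tensor_lunit K C (tensor_map K (field_module K) C \<epsilon> id (\<Delta> c)) = c"
    and counit_right: "c \<in> carrier C \<Longrightarrow>
      tensor_runit K C (tensor_map K C (field_module K) id \<epsilon> (\<Delta> c)) = c"

locale left_comodule = coalgebra K C \<Delta> \<epsilon> + M: module K M
  for K (structure) and C (structure) and \<Delta> \<epsilon> and M (structure) +
  fixes \<rho>
  assumes coaction_linear: "\<rho> \<in> linear_maps K M (tensor_product K C M)"
    and coaction_coassoc: "m \<in> carrier M \<Longrightarrow>
      tensor_assoc K C C M (tensor_map K (tensor_product K C C) M \<Delta> id (\<rho> m)) =
      tensor_map K C (tensor_product K C M) id \<rho> (\<rho> m)"
    and coaction_counit: "m \<in> carrier M \<Longrightarrow>
      tensor_lunit K M (tensor_map K (field_module K) M \<epsilon> id (\<rho> m)) = m"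

definition colinear ::
    "[('k, 'x) ring_scheme, ('k, 'c, 'y) module_scheme, ('k, 'm, 'z) module_scheme,
      'm \<Rightarrow> ('c \<times> 'm \<Rightarrow> 'k) set, 'm \<Rightarrow> 'm] \<Rightarrow> bool"
  where "colinear K C M \<rho> T \<longleftrightarrow>
    T \<in> linear_maps K M M \<and> (\<forall>m\<in>carrier M. \<rho> (T m) = tensor_map K C M id T (\<rho> m))"

locale rota_baxter_paired_comodule = left_comodule K C \<Delta> \<epsilon> M \<rho>
  for K (structure) and C (structure) and \<Delta> \<epsilon> and M (structure) and \<rho> +
  fixes P T lam
  assumes weight_closed: "lam \<in> carrier K"
    and P_linear: "P \<in> linear_maps K C C"
    and T_linear: "T \<in> linear_maps K M M"
    and rota_baxter: "m \<in> carrier M \<Longrightarrow>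
      tensor_map K C M P T (\<rho> m) =
        tensor_map K C M P id (\<rho> (T m)) \<oplus>\<^bsub>tensor_product K C M\<^esub>
        tensor_map K C M id T (\<rho> (T m)) \<oplus>\<^bsub>tensor_product K C M\<^esub>
        lam \<odot>\<^bsub>tensor_product K C M\<^esub> \<rho> (T m)"

locale generic_rota_baxter_paired_comodule = left_comodule K C \<Delta> \<epsilon> M \<rho>
  for K (structure) and C (structure) and \<Delta> \<epsilon> and M (structure) and \<rho> +
  fixes T lam
  assumes T_linear: "T \<in> linear_maps K M M"
    and generic: "P \<in> linear_maps K C C \<Longrightarrow> rota_baxter_paired_comodule K C \<Delta> \<epsilon> M \<rho> P T lam"

definition quasi_idempotent ::
    "[('k, 'x) ring_scheme, ('k, 'm, 'z) module_scheme, 'm \<Rightarrow> 'm, 'k] \<Rightarrow> bool"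
  where "quasi_idempotent K M T lam \<longleftrightarrow>
    T \<in> linear_maps K M M \<and> (\<forall>m\<in>carrier M. T (T m) = (\<ominus>\<^bsub>K\<^esub> lam) \<odot>\<^bsub>M\<^esub> T m)"

end

theory Submission
  imports Defs
begin

text \<open>Colinearity of \<open>T\<close> turns \<open>(P \<otimes> id) \<rho> T\<close> into \<open>(P \<otimes> id) (id \<otimes> T) \<rho> = (P \<otimes> T) \<rho>\<close>, so the
  terms involving \<open>P\<close> cancel from the Rota-Baxter identity.  What remains is
  \<open>\<rho> (T\<^sup>2 + \<lambda> T) = 0\<close>, and \<open>\<rho>\<close> is injective by the counit axiom.\<close>

section \<open>Linear maps and quotient modules\<close>

lemma linear_mapsI:
  assumes "\<And>v. v \<in> carrier V \<Longrightarrow> f v \<in> carrier W"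
    and "\<And>u v. \<lbrakk>u \<in> carrier V; v \<in> carrier V\<rbrakk> \<Longrightarrow> f (u \<oplus>\<^bsub>V\<^esub> v) = f u \<oplus>\<^bsub>W\<^esub> f v"
    and "\<And>a v. \<lbrakk>a \<in> carrier K; v \<in> carrier V\<rbrakk> \<Longrightarrow> f (a \<odot>\<^bsub>V\<^esub> v) = a \<odot>\<^bsub>W\<^esub> f v"
  shows "f \<in> linear_maps K V W"
  using assms by (auto simp: linear_maps_def)

lemma linear_mapsD:
  assumes "f \<in> linear_maps K V W"
  shows linear_maps_closed: "v \<in> carrier V \<Longrightarrow> f v \<in> carrier W"
    and linear_maps_add: "\<lbrakk>u \<in> carrier V; v \<in> carrier V\<rbrakk> \<Longrightarrow> f (u \<oplus>\<^bsub>V\<^esub> v) = f u \<oplus>\<^bsub>W\<^esub> f v"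
    and linear_maps_smult: "\<lbrakk>a \<in> carrier K; v \<in> carrier V\<rbrakk> \<Longrightarrow> f (a \<odot>\<^bsub>V\<^esub> v) = a \<odot>\<^bsub>W\<^esub> f v"
  using assms by (auto simp: linear_maps_def)

lemma linear_maps_id: "id \<in> linear_maps K V V"
  by (simp add: linear_maps_def)

lemma linear_maps_comp:
  "\<lbrakk>f \<in> linear_maps K U V; g \<in> linear_maps K V W\<rbrakk> \<Longrightarrow> g \<circ> f \<in> linear_maps K U W"
  by (auto simp: linear_maps_def Pi_iff)

text \<open>Makes preservation of zero and of negatives available for linear maps, whose definition
  mentions only sums and scalar multiples.\<close>

lemma linear_maps_abelian_group_hom:
  assumes "module K V" "module K W" "f \<in> linear_maps K V W"
  shows "abelian_group_hom V W f"
proof -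
  interpret V: module K V by fact
  interpret W: module K W by fact
  show ?thesis
    by (intro abelian_group_homI V.abelian_group_axioms W.abelian_group_axioms
        group_hom.intro group_hom_axioms.intro V.a_group W.a_group)
      (auto simp: hom_def linear_mapsD[OF assms(3)])
qed

text \<open>Each closure condition passes to intersections. The family has to be nonempty because
  \<open>\<Inter>{}\<close> is the whole type, not the carrier.\<close>

lemma (in module) submodule_Inter:
  assumes "\<H> \<noteq> {}" and sub: "\<And>H. H \<in> \<H> \<Longrightarrow> submodule H R M"
  shows "submodule (\<Inter>\<H>) R M"
proof (rule submoduleI)
  show "\<Inter>\<H> \<subseteq> carrier M"
    using assms(1) submoduleE(1)[OF sub] by blast
  show "\<zero>\<^bsub>M\<^esub> \<in> \<Inter>\<H>"
    using subgroup.one_closed[OF submodule.axioms(1)[OF sub]] by auto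
qed (use submoduleE[OF sub] in auto)

text \<open>Serves to show that a linear map killing the tensor generators kills the whole submodule
  of relations.\<close>

lemma (in module) submodule_kernel:
  assumes "module R U" and f: "f \<in> linear_maps R M U"
  shows "submodule {x \<in> carrier M. f x = \<zero>\<^bsub>U\<^esub>} R M"
proof -
  interpret U: module R U by fact
  interpret f: abelian_group_hom M U f
    using linear_maps_abelian_group_hom[OF module_axioms assms] .
  show ?thesis
    by (rule submoduleI) (auto simp: linear_maps_smult[OF f])
qed

text \<open>In a commutative group every additive subgroup is normal; this view gives access to the
  coset calculus of \<open>abelian_subgroup\<close>.\<close>

lemma (in module) submodule_abelian_subgroup:
  assumes "submodule H R M"
  shows "abelian_subgroup H M"
  using assms by (intro abelian_subgroupI3 additive_subgroup.intro abelian_group_axioms)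
    (rule submodule.axioms(1))

section \<open>Quotients of a module by a submodule\<close>

context module
begin

context
  fixes H
  assumes H: "submodule H R M"
begin

interpretation H: abelian_subgroup H M
  by (rule submodule_abelian_subgroup[OF H])

lemma carrier_quotient_module: "carrier (quotient_module M H) = (\<lambda>x. H +>\<^bsub>M\<^esub> x) ` carrier M"
  by (auto simp: quotient_module_def A_RCOSETS_def')

lemma quotient_module_zero: "\<zero>\<^bsub>quotient_module M H\<^esub> = H +>\<^bsub>M\<^esub> \<zero>\<^bsub>M\<^esub>"
  using H.a_rcos_const[OF H.zero_closed] by (simp add: quotient_module_def)

lemma quotient_module_add:
  "\<lbrakk>x \<in> carrier M; y \<in> carrier M\<rbrakk> \<Longrightarrow>
    (H +>\<^bsub>M\<^esub> x) \<oplus>\<^bsub>quotient_module M H\<^esub> (H +>\<^bsub>M\<^esub> y) = H +>\<^bsub>M\<^esub> (x \<oplus>\<^bsub>M\<^esub> y)"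
  by (simp add: quotient_module_def H.a_rcos_sum)

text \<open>If \<open>y\<close> and \<open>x\<close> differ by an element of \<open>H\<close>, then
  so do their multiples by \<open>a\<close>, because \<open>H\<close> is closed under scalars. Hence
  the union defining the scalar multiple runs over copies of a single coset.\<close>

lemma quotient_module_smult:
  assumes a: "a \<in> carrier R" and x: "x \<in> carrier M"
  shows "a \<odot>\<^bsub>quotient_module M H\<^esub> (H +>\<^bsub>M\<^esub> x) = H +>\<^bsub>M\<^esub> (a \<odot>\<^bsub>M\<^esub> x)"
proof -
  have "H +>\<^bsub>M\<^esub> (a \<odot>\<^bsub>M\<^esub> y) = H +>\<^bsub>M\<^esub> (a \<odot>\<^bsub>M\<^esub> x)" if y: "y \<in> H +>\<^bsub>M\<^esub> x" for y
  proof -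
    have yc: "y \<in> carrier M" by (rule H.a_elemrcos_carrier[OF x y])
    have "a \<odot>\<^bsub>M\<^esub> (y \<oplus>\<^bsub>M\<^esub> \<ominus>\<^bsub>M\<^esub> x) \<in> H"
      using submoduleE(4)[OF H a H.a_rcos_module_imp[OF x y]] .
    then have "a \<odot>\<^bsub>M\<^esub> y \<oplus>\<^bsub>M\<^esub> \<ominus>\<^bsub>M\<^esub> (a \<odot>\<^bsub>M\<^esub> x) \<in> H"
      using a x yc by (simp add: smult_r_distr smult_r_minus)
    then have "a \<odot>\<^bsub>M\<^esub> y \<in> H +>\<^bsub>M\<^esub> (a \<odot>\<^bsub>M\<^esub> x)"
      using a x yc by (intro H.a_rcos_module_rev) auto
    from H.a_repr_independence'[OF this] show ?thesis
      using a x by simp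
  qed
  \<comment> \<open>The index set of the union must be nonempty for the union to equal the common
    coset.\<close>
  moreover have "x \<in> H +>\<^bsub>M\<^esub> x" using x by (rule H.a_rcos_self)
  ultimately have "(\<Union>y\<in>H +>\<^bsub>M\<^esub> x. H +>\<^bsub>M\<^esub> (a \<odot>\<^bsub>M\<^esub> y)) = H +>\<^bsub>M\<^esub> (a \<odot>\<^bsub>M\<^esub> x)"
    by blast
  then show ?thesis by (simp add: quotient_module_def)
qed

text \<open>Once every class is written as the coset of a representative, each axiom reduces to the
  same axiom in \<open>M\<close>.\<close>

lemma quotient_module_is_module: "module R (quotient_module M H)"
proof (rule moduleI)
  let ?Q = "quotient_module M H"
  show "abelian_group ?Q"
  proof (rule abelian_groupI)
    fix X assume "X \<in> carrier ?Q"
    then obtain x where x: "x \<in> carrier M" "X = H +>\<^bsub>M\<^esub> x"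
      by (auto simp: carrier_quotient_module)
    then show "\<exists>Y\<in>carrier ?Q. Y \<oplus>\<^bsub>?Q\<^esub> X = \<zero>\<^bsub>?Q\<^esub>"
      by (intro bexI[of _ "H +>\<^bsub>M\<^esub> (\<ominus>\<^bsub>M\<^esub> x)"])
        (auto simp: carrier_quotient_module quotient_module_add quotient_module_zero M.l_neg)
  qed (auto simp: carrier_quotient_module quotient_module_add quotient_module_zero
      M.a_ac)
qed (auto simp: carrier_quotient_module quotient_module_add quotient_module_smult
    smult_l_distr smult_r_distr smult_assoc1 intro: R.is_cring)

lemma coset_linear: "(\<lambda>x. H +>\<^bsub>M\<^esub> x) \<in> linear_maps R M (quotient_module M H)"
  by (rule linear_mapsI)
    (auto simp: carrier_quotient_module quotient_module_add quotient_module_smult)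

end

end


section \<open>Free modules\<close>

lemma free_module_sel:
  "\<zero>\<^bsub>free_module K I\<^esub> = (\<lambda>i. \<zero>\<^bsub>K\<^esub>)"
  "x \<oplus>\<^bsub>free_module K I\<^esub> y = (\<lambda>i. x i \<oplus>\<^bsub>K\<^esub> y i)"
  "a \<odot>\<^bsub>free_module K I\<^esub> x = (\<lambda>i. a \<otimes>\<^bsub>K\<^esub> x i)"
  by (simp_all add: free_module_def)

lemma free_module_carrier:
  "x \<in> carrier (free_module K I) \<longleftrightarrow>
    (\<forall>i. x i \<in> carrier K) \<and> finite {i. x i \<noteq> \<zero>\<^bsub>K\<^esub>} \<and> {i. x i \<noteq> \<zero>\<^bsub>K\<^esub>} \<subseteq> I"
  by (simp add: free_module_def)

text \<open>The support of a sum lies in the union of the two supports, so it stays finite and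
  inside \<open>I\<close>.\<close>

lemma (in cring) free_module_add_closed:
  assumes "x \<in> carrier (free_module R I)" "y \<in> carrier (free_module R I)"
  shows "x \<oplus>\<^bsub>free_module R I\<^esub> y \<in> carrier (free_module R I)"
proof -
  have sub: "{i. x i \<oplus> y i \<noteq> \<zero>} \<subseteq> {i. x i \<noteq> \<zero>} \<union> {i. y i \<noteq> \<zero>}"
    by auto
  show ?thesis
    using assms finite_subset[OF sub] sub by (auto simp: free_module_carrier free_module_sel)
qed

lemma (in cring) free_module_smult_closed:
  assumes "a \<in> carrier R" "x \<in> carrier (free_module R I)"
  shows "a \<odot>\<^bsub>free_module R I\<^esub> x \<in> carrier (free_module R I)"
proof -
  have sub: "{i. a \<otimes> x i \<noteq> \<zero>} \<subseteq> {i. x i \<noteq> \<zero>}"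
    using assms by auto
  show ?thesis
    using assms finite_subset[OF sub] sub by (auto simp: free_module_carrier free_module_sel)
qed

lemma (in cring) free_module_is_module: "module R (free_module R I)"
proof (rule moduleI)
  let ?F = "free_module R I"
  show "abelian_group ?F"
  proof (rule abelian_groupI)
    fix x assume x: "x \<in> carrier ?F"
    show "\<exists>y\<in>carrier ?F. y \<oplus>\<^bsub>?F\<^esub> x = \<zero>\<^bsub>?F\<^esub>"
    proof (rule bexI)
      \<comment> \<open>Taking the negative as a scalar multiple by \<open>\<ominus> \<one>\<close>
        reduces its membership in the carrier to closure under scalars.\<close>
      show "(\<ominus> \<one>) \<odot>\<^bsub>?F\<^esub> x \<in> carrier ?F"
        using x by (simp add: free_module_smult_closed)
      show "((\<ominus> \<one>) \<odot>\<^bsub>?F\<^esub> x) \<oplus>\<^bsub>?F\<^esub> x = \<zero>\<^bsub>?F\<^esub>"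
        using x by (auto simp: free_module_sel free_module_carrier l_minus l_neg)
    qed
  qed (simp_all add: free_module_add_closed, auto simp: free_module_sel free_module_carrier a_ac)
qed (simp_all add: free_module_smult_closed is_cring,
    auto simp: free_module_sel free_module_carrier l_distr r_distr m_assoc)

lemma (in cring) free_basis_closed: "i \<in> I \<Longrightarrow> free_basis R i \<in> carrier (free_module R I)"
  by (auto simp: free_basis_def free_module_carrier)

text \<open>Uniqueness of linear extension from the basis: every element has finite support, so it
  is built from zero by adding finitely many multiples of basis vectors.\<close>

lemma (in cring) free_module_linear_ext:
  assumes "module R U" and f: "f \<in> linear_maps R (free_module R I) U"
    and g: "g \<in> linear_maps R (free_module R I) U"
    and eq: "\<And>i. i \<in> I \<Longrightarrow> f (free_basis R i) = g (free_basis R i)"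
    and x: "x \<in> carrier (free_module R I)"
  shows "f x = g x"
proof -
  let ?F = "free_module R I"
  interpret F: module R ?F by (rule free_module_is_module)
  interpret U: module R U by fact
  interpret f: abelian_group_hom ?F U f
    using linear_maps_abelian_group_hom[OF F.module_axioms U.module_axioms f] .
  interpret g: abelian_group_hom ?F U g
    using linear_maps_abelian_group_hom[OF F.module_axioms U.module_axioms g] .
  \<comment> \<open>The induction runs over a finite set \<open>A\<close> containing the support,
    not over the support itself; a zero coefficient at the new index then falls directly under the
    induction hypothesis.\<close>
  have "f y = g y" if "finite A" "y \<in> carrier ?F" "{i. y i \<noteq> \<zero>} \<subseteq> A" for A y
    using that
  proof (induction A arbitrary: y rule: finite_induct)
    case empty
    then have "y = \<zero>\<^bsub>?F\<^esub>" by (auto simp: free_module_sel)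
    then show ?case by simp
  next
    case (insert i A)
    show ?case
    proof (cases "y i = \<zero>")
      case True
      then show ?thesis using insert by (intro insert.IH) auto
    next
      case False
      \<comment> \<open>Erasing the coordinate at \<open>i\<close> leaves an element supported in
        \<open>A\<close>, and \<open>y\<close> is recovered by adding back one multiple of the basis
        vector at \<open>i\<close>.\<close>
      define z where "z = y(i := \<zero>)"
      have sub: "{j. z j \<noteq> \<zero>} \<subseteq> {j. y j \<noteq> \<zero>} \<inter> A"
        using insert.prems by (auto simp: z_def)
      then have z: "z \<in> carrier ?F"
        using insert.prems(1) finite_subset[OF sub] by (auto simp: free_module_carrier z_def)
      have i: "i \<in> I" and yi: "y i \<in> carrier R"
        using insert.prems(1) False by (auto simp: free_module_carrier)
      have y: "y = z \<oplus>\<^bsub>?F\<^esub> y i \<odot>\<^bsub>?F\<^esub> free_basis R i"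
        using insert.prems(1)
        by (auto simp: z_def free_module_sel free_basis_def free_module_carrier)
      have b: "free_basis R i \<in> carrier ?F"
        using i by (rule free_basis_closed)
      have "f z = g z" using sub z by (intro insert.IH) auto
      then have "f (z \<oplus>\<^bsub>?F\<^esub> y i \<odot>\<^bsub>?F\<^esub> free_basis R i) = g (z \<oplus>\<^bsub>?F\<^esub> y i \<odot>\<^bsub>?F\<^esub> free_basis R i)"
        using z yi b eq[OF i] by (simp add: linear_maps_smult[OF f] linear_maps_smult[OF g])
      then show ?thesis using y by simp
    qed
  qed
  then show ?thesis using x by (auto simp: free_module_carrier)
qed

section \<open>Linear extension from the basis of a free module\<close>

text \<open>The linear extension of \<open>\<gamma>\<close> to the free module. The sum is taken
  over the support, as in \<open>tensor_lift\<close>, so that \<open>tensor_lift\<close> is seen at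
  once to collect the values of a \<open>free_lift\<close> over a class.\<close>

definition free_lift ::
    "[('k, 'x) ring_scheme, ('k, 'u, 'y) module_scheme, 'i \<Rightarrow> 'u, 'i \<Rightarrow> 'k] \<Rightarrow> 'u"
  where "free_lift K U \<gamma> x = (\<Oplus>\<^bsub>U\<^esub>i\<in>{i. x i \<noteq> \<zero>\<^bsub>K\<^esub>}. x i \<odot>\<^bsub>U\<^esub> \<gamma> i)"

text \<open>Indices outside the support contribute zero. This allows elements with different
  supports to be summed over one index set.\<close>

lemma (in module) free_lift_superset:
  assumes "\<gamma> \<in> I \<rightarrow> carrier M" "x \<in> carrier (free_module R I)"
    and "finite A" "{i. x i \<noteq> \<zero>} \<subseteq> A" "A \<subseteq> I"
  shows "free_lift R M \<gamma> x = (\<Oplus>\<^bsub>M\<^esub>i\<in>A. x i \<odot>\<^bsub>M\<^esub> \<gamma> i)"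
proof -
  have "\<gamma> i \<in> carrier M" if "i \<in> A" for i
    using assms that by auto
  then show ?thesis
    unfolding free_lift_def using assms
    by (intro M.add.finprod_mono_neutral_cong_left) (auto simp: free_module_carrier)
qed

lemma (in module) free_lift_linear:
  assumes \<gamma>: "\<gamma> \<in> I \<rightarrow> carrier M"
  shows "free_lift R M \<gamma> \<in> linear_maps R (free_module R I) M"
proof (rule linear_mapsI)
  let ?F = "free_module R I"
  interpret F: module R ?F by (rule R.free_module_is_module)
  fix x assume x: "x \<in> carrier ?F"
  let ?A = "{i. x i \<noteq> \<zero>}"
  have A: "finite ?A" "?A \<subseteq> I" using x by (auto simp: free_module_carrier)
  have xc: "x i \<in> carrier R" for i using x by (auto simp: free_module_carrier)
  have \<gamma>A: "\<gamma> i \<in> carrier M" if "i \<in> ?A" for i using \<gamma> A that by auto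
  show "free_lift R M \<gamma> x \<in> carrier M"
    unfolding free_lift_def by (intro M.finsum_closed) (auto simp: xc \<gamma>A)
  show "free_lift R M \<gamma> (a \<odot>\<^bsub>?F\<^esub> x) = a \<odot>\<^bsub>M\<^esub> free_lift R M \<gamma> x" if a: "a \<in> carrier R" for a
  proof -
    \<comment> \<open>Scaling may shrink the support, so both sums are taken over the support of
      \<open>x\<close>.\<close>
    have "free_lift R M \<gamma> (a \<odot>\<^bsub>?F\<^esub> x) = (\<Oplus>\<^bsub>M\<^esub>i\<in>?A. (a \<odot>\<^bsub>?F\<^esub> x) i \<odot>\<^bsub>M\<^esub> \<gamma> i)"
      using a A by (intro free_lift_superset[OF \<gamma> F.smult_closed[OF a x]]) (auto simp: free_module_sel)
    also have "\<dots> = (\<Oplus>\<^bsub>M\<^esub>i\<in>?A. a \<odot>\<^bsub>M\<^esub> (x i \<odot>\<^bsub>M\<^esub> \<gamma> i))"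
      using a by (intro M.finsum_cong') (auto simp: xc \<gamma>A smult_assoc1 free_module_sel)
    also have "\<dots> = a \<odot>\<^bsub>M\<^esub> (\<Oplus>\<^bsub>M\<^esub>i\<in>?A. x i \<odot>\<^bsub>M\<^esub> \<gamma> i)"
      using a A by (intro finsum_smult_ldistr[symmetric]) (auto simp: xc \<gamma>A)
    finally show ?thesis by (simp add: free_lift_def)
  qed
  show "free_lift R M \<gamma> (x \<oplus>\<^bsub>?F\<^esub> y) = free_lift R M \<gamma> x \<oplus>\<^bsub>M\<^esub> free_lift R M \<gamma> y"
    if y: "y \<in> carrier ?F" for y
  proof -
    \<comment> \<open>Cancellation may make the support of the sum smaller than this union; the
      union serves as common index set for \<open>x\<close>, \<open>y\<close> and their sum.\<close>
    let ?B = "?A \<union> {i. y i \<noteq> \<zero>}"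
    have B: "finite ?B" "?B \<subseteq> I" using x y by (auto simp: free_module_carrier)
    have yc: "y i \<in> carrier R" for i using y by (auto simp: free_module_carrier)
    have \<gamma>B: "\<gamma> i \<in> carrier M" if "i \<in> ?B" for i using \<gamma> B that by auto
    have "free_lift R M \<gamma> (x \<oplus>\<^bsub>?F\<^esub> y) = (\<Oplus>\<^bsub>M\<^esub>i\<in>?B. (x \<oplus>\<^bsub>?F\<^esub> y) i \<odot>\<^bsub>M\<^esub> \<gamma> i)"
      using B by (intro free_lift_superset[OF \<gamma> F.M.add.m_closed[OF x y, simplified]]) (auto simp: free_module_sel)
    also have "\<dots> = (\<Oplus>\<^bsub>M\<^esub>i\<in>?B. x i \<odot>\<^bsub>M\<^esub> \<gamma> i \<oplus>\<^bsub>M\<^esub> y i \<odot>\<^bsub>M\<^esub> \<gamma> i)"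
      by (intro M.finsum_cong') (auto simp: xc yc \<gamma>B smult_l_distr free_module_sel)
    also have "\<dots> = (\<Oplus>\<^bsub>M\<^esub>i\<in>?B. x i \<odot>\<^bsub>M\<^esub> \<gamma> i) \<oplus>\<^bsub>M\<^esub> (\<Oplus>\<^bsub>M\<^esub>i\<in>?B. y i \<odot>\<^bsub>M\<^esub> \<gamma> i)"
      by (intro M.finsum_addf) (auto simp: xc yc \<gamma>B)
    finally show ?thesis
      using free_lift_superset[OF \<gamma> x B(1) _ B(2)] free_lift_superset[OF \<gamma> y B(1) _ B(2)] by auto
  qed
qed

text \<open>Summing over \<open>{i}\<close> instead of the support also covers the trivial ring,
  where the support of a basis vector is empty.\<close>

lemma (in module) free_lift_basis:
  assumes "\<gamma> \<in> I \<rightarrow> carrier M" "i \<in> I"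
  shows "free_lift R M \<gamma> (free_basis R i) = \<gamma> i"
proof -
  have "free_lift R M \<gamma> (free_basis R i) = (\<Oplus>\<^bsub>M\<^esub>j\<in>{i}. free_basis R i j \<odot>\<^bsub>M\<^esub> \<gamma> j)"
    using assms by (intro free_lift_superset R.free_basis_closed) (auto simp: free_basis_def)
  also have "\<dots> = \<gamma> i"
    using funcset_mem[OF assms] by (simp add: free_basis_def)
  finally show ?thesis .
qed


section \<open>Tensor products\<close>

definition bilinear_map ::
    "[('k, 'x) ring_scheme, ('k, 'v, 'y) module_scheme, ('k, 'w, 'z) module_scheme,
      ('k, 'u, 'q) module_scheme, 'v \<Rightarrow> 'w \<Rightarrow> 'u] \<Rightarrow> bool"
  where "bilinear_map K V W U \<beta> \<longleftrightarrow>
    (\<forall>v\<in>carrier V. \<beta> v \<in> linear_maps K W U) \<and>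
    (\<forall>w\<in>carrier W. (\<lambda>v. \<beta> v w) \<in> linear_maps K V U)"

text \<open>The four families of bilinearity relations that occur inside
  \<open>tensor_relations\<close>, named separately so that the relations can be handled as the
  smallest submodule containing them.\<close>

definition tensor_generators ::
    "[('k, 'x) ring_scheme, ('k, 'v, 'y) module_scheme, ('k, 'w, 'z) module_scheme] \<Rightarrow> ('v \<times> 'w \<Rightarrow> 'k) set"
  where "tensor_generators K V W =
    (let F = free_module K (carrier V \<times> carrier W); d = (\<lambda>v w. free_basis K (v, w))
     in {d (u \<oplus>\<^bsub>V\<^esub> v) w \<ominus>\<^bsub>F\<^esub> (d u w \<oplus>\<^bsub>F\<^esub> d v w) | u v w.
          u \<in> carrier V \<and> v \<in> carrier V \<and> w \<in> carrier W} \<union>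
       {d v (w \<oplus>\<^bsub>W\<^esub> z) \<ominus>\<^bsub>F\<^esub> (d v w \<oplus>\<^bsub>F\<^esub> d v z) | v w z.
          v \<in> carrier V \<and> w \<in> carrier W \<and> z \<in> carrier W} \<union>
       {d (a \<odot>\<^bsub>V\<^esub> v) w \<ominus>\<^bsub>F\<^esub> a \<odot>\<^bsub>F\<^esub> d v w | a v w.
          a \<in> carrier K \<and> v \<in> carrier V \<and> w \<in> carrier W} \<union>
       {d v (a \<odot>\<^bsub>W\<^esub> w) \<ominus>\<^bsub>F\<^esub> a \<odot>\<^bsub>F\<^esub> d v w | a v w.
          a \<in> carrier K \<and> v \<in> carrier V \<and> w \<in> carrier W})"

lemma tensor_relations_eq:
  "tensor_relations K V W =
    \<Inter>{H. submodule H K (free_module K (carrier V \<times> carrier W)) \<and> tensor_generators K V W \<subseteq> H}"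
  by (simp add: tensor_relations_def tensor_generators_def Let_def)

section \<open>The tensor product as a quotient of a free module\<close>

locale tensor_spaces = V: module K V + W: module K W
  for K (structure) and V (structure) and W (structure)
begin

abbreviation "F \<equiv> free_module K (carrier V \<times> carrier W)"
abbreviation "H \<equiv> tensor_relations K V W"
abbreviation "VW \<equiv> tensor_product K V W"
abbreviation "d v w \<equiv> free_basis K (v, w)"

sublocale F: module K F
  by (rule V.R.free_module_is_module)

lemma basis_closed: "\<lbrakk>v \<in> carrier V; w \<in> carrier W\<rbrakk> \<Longrightarrow> d v w \<in> carrier F"
  by (simp add: V.R.free_basis_closed)

lemma tensor_generators_subset: "tensor_generators K V W \<subseteq> carrier F"
  by (auto simp: tensor_generators_def Let_def basis_closed)

text \<open>The whole free module belongs to the intersected family, so the family is nonempty and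
  the intersection is a submodule.\<close>

lemma tensor_relations_submodule: "submodule H K F"
  unfolding tensor_relations_eq
  using F.carrier_is_submodule tensor_generators_subset by (intro F.submodule_Inter) auto

lemma tensor_generators_relations: "tensor_generators K V W \<subseteq> H"
  unfolding tensor_relations_eq by blast

sublocale VW: module K VW
  unfolding tensor_product_def
  by (rule F.quotient_module_is_module[OF tensor_relations_submodule])

sublocale H: abelian_subgroup H F
  by (rule F.submodule_abelian_subgroup[OF tensor_relations_submodule])

lemma carrier_tensor_product: "carrier VW = (\<lambda>x. H +>\<^bsub>F\<^esub> x) ` carrier F"
  unfolding tensor_product_def
  by (rule F.carrier_quotient_module[OF tensor_relations_submodule])

lemma class_linear: "(\<lambda>x. H +>\<^bsub>F\<^esub> x) \<in> linear_maps K F VW"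
  unfolding tensor_product_def
  by (rule F.coset_linear[OF tensor_relations_submodule])

lemma pure_tensor_closed:
  "\<lbrakk>v \<in> carrier V; w \<in> carrier W\<rbrakk> \<Longrightarrow> pure_tensor K V W v w \<in> carrier VW"
  unfolding pure_tensor_def by (rule linear_maps_closed[OF class_linear basis_closed])

lemma class_eqI:
  assumes "x \<in> carrier F" "y \<in> carrier F" "x \<ominus>\<^bsub>F\<^esub> y \<in> H"
  shows "H +>\<^bsub>F\<^esub> x = H +>\<^bsub>F\<^esub> y"
  using assms H.a_rcos_module_rev[of y x] H.a_repr_independence'[of x y]
  by (simp add: F.M.minus_eq)

text \<open>Each of the four laws of bilinearity corresponds to one family of generators: the two
  sides differ by a generator, so their classes coincide.\<close>

lemma pure_tensor_bilinear: "bilinear_map K V W VW (pure_tensor K V W)"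
proof -
  note gen = subsetD[OF tensor_generators_relations]
  \<comment> \<open>Reversed, these rules fold sums and multiples of classes into the class of a
    single element, the shape that \<open>class_eqI\<close> expects.\<close>
  note lin = linear_mapsD(2,3)[OF class_linear, symmetric]
  have "pure_tensor K V W v \<in> linear_maps K W VW" if v: "v \<in> carrier V" for v
  proof (rule linear_mapsI)
    fix w z assume wz: "w \<in> carrier W" "z \<in> carrier W"
    have "d v (w \<oplus>\<^bsub>W\<^esub> z) \<ominus>\<^bsub>F\<^esub> (d v w \<oplus>\<^bsub>F\<^esub> d v z) \<in> H"
      using v wz by (intro gen) (unfold tensor_generators_def Let_def, blast)
    then show "pure_tensor K V W v (w \<oplus>\<^bsub>W\<^esub> z) = pure_tensor K V W v w \<oplus>\<^bsub>VW\<^esub> pure_tensor K V W v z"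
      using v wz unfolding pure_tensor_def
      by (simp add: lin basis_closed) (intro class_eqI, auto simp: basis_closed)
  next
    fix a w assume aw: "a \<in> carrier K" "w \<in> carrier W"
    have "d v (a \<odot>\<^bsub>W\<^esub> w) \<ominus>\<^bsub>F\<^esub> a \<odot>\<^bsub>F\<^esub> d v w \<in> H"
      using v aw by (intro gen) (unfold tensor_generators_def Let_def, blast)
    then show "pure_tensor K V W v (a \<odot>\<^bsub>W\<^esub> w) = a \<odot>\<^bsub>VW\<^esub> pure_tensor K V W v w"
      using v aw unfolding pure_tensor_def
      by (simp add: lin basis_closed) (intro class_eqI, auto simp: basis_closed)
  qed (simp add: v pure_tensor_closed)
  moreover have "(\<lambda>v. pure_tensor K V W v w) \<in> linear_maps K V VW" if w: "w \<in> carrier W" for w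
  proof (rule linear_mapsI)
    fix u v assume uv: "u \<in> carrier V" "v \<in> carrier V"
    have "d (u \<oplus>\<^bsub>V\<^esub> v) w \<ominus>\<^bsub>F\<^esub> (d u w \<oplus>\<^bsub>F\<^esub> d v w) \<in> H"
      using w uv by (intro gen) (unfold tensor_generators_def Let_def, blast)
    then show "pure_tensor K V W (u \<oplus>\<^bsub>V\<^esub> v) w = pure_tensor K V W u w \<oplus>\<^bsub>VW\<^esub> pure_tensor K V W v w"
      using w uv unfolding pure_tensor_def
      by (simp add: lin basis_closed) (intro class_eqI, auto simp: basis_closed)
  next
    fix a v assume av: "a \<in> carrier K" "v \<in> carrier V"
    have "d (a \<odot>\<^bsub>V\<^esub> v) w \<ominus>\<^bsub>F\<^esub> a \<odot>\<^bsub>F\<^esub> d v w \<in> H"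
      using w av by (intro gen) (unfold tensor_generators_def Let_def, blast)
    then show "pure_tensor K V W (a \<odot>\<^bsub>V\<^esub> v) w = a \<odot>\<^bsub>VW\<^esub> pure_tensor K V W v w"
      using w av unfolding pure_tensor_def
      by (simp add: lin basis_closed) (intro class_eqI, auto simp: basis_closed)
  qed (simp add: w pure_tensor_closed)
  ultimately show ?thesis by (simp add: bilinear_map_def)
qed

text \<open>Composing with the class map leads back to \<open>free_module_linear_ext\<close>, since
  pure tensors are exactly the classes of basis vectors.\<close>

lemma tensor_linear_ext:
  assumes "module K U" and f: "f \<in> linear_maps K VW U" and g: "g \<in> linear_maps K VW U"
    and eq: "\<And>v w. \<lbrakk>v \<in> carrier V; w \<in> carrier W\<rbrakk> \<Longrightarrow>
      f (pure_tensor K V W v w) = g (pure_tensor K V W v w)"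
    and X: "X \<in> carrier VW"
  shows "f X = g X"
proof -
  obtain x where x: "x \<in> carrier F" "X = H +>\<^bsub>F\<^esub> x"
    using X by (auto simp: carrier_tensor_product)
  have "(f \<circ> (\<lambda>x. H +>\<^bsub>F\<^esub> x)) x = (g \<circ> (\<lambda>x. H +>\<^bsub>F\<^esub> x)) x"
    by (rule V.R.free_module_linear_ext[OF assms(1) linear_maps_comp[OF class_linear f]
          linear_maps_comp[OF class_linear g] _ x(1)]) (use eq in \<open>auto simp: pure_tensor_def\<close>)
  then show ?thesis by (simp add: x(2))
qed

section \<open>The universal property of the tensor product\<close>

context
  fixes U and \<beta>
  assumes U: "module K U" and \<beta>: "bilinear_map K V W U \<beta>"
begin

interpretation U: module K U by (rule U)

abbreviation "L \<equiv> free_lift K U (\<lambda>p. \<beta> (fst p) (snd p))"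

lemma \<beta>_closed: "(\<lambda>p. \<beta> (fst p) (snd p)) \<in> carrier V \<times> carrier W \<rightarrow> carrier U"
  using \<beta> linear_maps_closed[of "\<beta> _" K W U] by (fastforce simp: bilinear_map_def)

lemma L_linear: "L \<in> linear_maps K F U"
  by (rule U.free_lift_linear[OF \<beta>_closed])

interpretation L: abelian_group_hom F U L
  using linear_maps_abelian_group_hom[OF F.module_axioms U L_linear] .

lemma L_basis: "\<lbrakk>v \<in> carrier V; w \<in> carrier W\<rbrakk> \<Longrightarrow> L (d v w) = \<beta> v w"
  by (simp add: U.free_lift_basis[OF \<beta>_closed])

text \<open>By bilinearity of \<open>\<beta>\<close> the kernel of \<open>L\<close> contains the
  generators. Being a submodule, it is one of the sets whose intersection is
  \<open>H\<close>.\<close>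

lemma tensor_relations_subset_kernel: "H \<subseteq> {x \<in> carrier F. L x = \<zero>\<^bsub>U\<^esub>}"
proof -
  note b = L_basis basis_closed
  have \<beta>c: "\<beta> v w \<in> carrier U" if "v \<in> carrier V" "w \<in> carrier W" for v w
    using funcset_mem[OF \<beta>_closed, of "(v, w)"] that by simp
  have r: "\<beta> v (w \<oplus>\<^bsub>W\<^esub> z) = \<beta> v w \<oplus>\<^bsub>U\<^esub> \<beta> v z" "a \<in> carrier K \<Longrightarrow> \<beta> v (a \<odot>\<^bsub>W\<^esub> w) = a \<odot>\<^bsub>U\<^esub> \<beta> v w"
    if "v \<in> carrier V" "w \<in> carrier W" "z \<in> carrier W" for a v w z
    using \<beta> that by (auto simp: bilinear_map_def linear_mapsD)
  have l: "\<beta> (u \<oplus>\<^bsub>V\<^esub> v) w = \<beta> u w \<oplus>\<^bsub>U\<^esub> \<beta> v w" "a \<in> carrier K \<Longrightarrow> \<beta> (a \<odot>\<^bsub>V\<^esub> v) w = a \<odot>\<^bsub>U\<^esub> \<beta> v w"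
    if "u \<in> carrier V" "v \<in> carrier V" "w \<in> carrier W" for a u v w
    using \<beta> that linear_mapsD[of "\<lambda>v. \<beta> v w" K V U] by (auto simp: bilinear_map_def)
  have "L x = \<zero>\<^bsub>U\<^esub>" if "x \<in> tensor_generators K V W" for x
    using that unfolding tensor_generators_def Let_def
    by (auto simp: b linear_maps_smult[OF L_linear] F.M.minus_eq U.M.r_neg r l \<beta>c)
  then have "tensor_generators K V W \<subseteq> {x \<in> carrier F. L x = \<zero>\<^bsub>U\<^esub>}"
    using tensor_generators_subset by blast
  then show ?thesis
    unfolding tensor_relations_eq using F.submodule_kernel[OF U L_linear] by blast
qed

text \<open>Two representatives differ by an element of \<open>H\<close>, which \<open>L\<close>
  kills. So the image of a class under \<open>L\<close> is a singleton, and \<open>the_elem\<close>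
  returns its only value.\<close>

lemma tensor_lift_class:
  assumes x: "x \<in> carrier F"
  shows "tensor_lift K U \<beta> (H +>\<^bsub>F\<^esub> x) = L x"
proof -
  have "L y = L x" if y: "y \<in> H +>\<^bsub>F\<^esub> x" for y
  proof -
    have yc: "y \<in> carrier F" by (rule H.a_elemrcos_carrier[OF x y])
    have "L (y \<oplus>\<^bsub>F\<^esub> \<ominus>\<^bsub>F\<^esub> x) = \<zero>\<^bsub>U\<^esub>"
      using H.a_rcos_module_imp[OF x y] tensor_relations_subset_kernel by blast
    then have "L y \<oplus>\<^bsub>U\<^esub> \<ominus>\<^bsub>U\<^esub> L x = \<zero>\<^bsub>U\<^esub>"
      using x yc by simp
    from U.M.minus_equality[OF this] show ?thesis using x yc by simp
  qed
  then have "L ` (H +>\<^bsub>F\<^esub> x) = {L x}"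
    using H.a_rcos_self[OF x] by blast
  then show ?thesis by (simp add: tensor_lift_def free_lift_def)
qed

lemma tensor_lift_pure:
  "\<lbrakk>v \<in> carrier V; w \<in> carrier W\<rbrakk> \<Longrightarrow> tensor_lift K U \<beta> (pure_tensor K V W v w) = \<beta> v w"
  by (simp add: pure_tensor_def tensor_lift_class basis_closed L_basis)

lemma tensor_lift_linear: "tensor_lift K U \<beta> \<in> linear_maps K VW U"
  by (rule linear_mapsI)
    (auto simp: carrier_tensor_product tensor_lift_class linear_mapsD[OF L_linear]
      linear_mapsD(2,3)[OF class_linear, symmetric])

end

end

section \<open>Functoriality of the tensor product\<close>

text \<open>Applied to \<open>pure_tensor\<close>, this gives the bilinear map that
  \<open>tensor_map\<close> lifts.\<close>

lemma bilinear_map_comp: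
  assumes "bilinear_map K V W U \<beta>" "f \<in> linear_maps K A V" "g \<in> linear_maps K B W"
  shows "bilinear_map K A B U (\<lambda>a b. \<beta> (f a) (g b))"
  unfolding bilinear_map_def
proof (intro conjI ballI)
  fix a assume "a \<in> carrier A"
  then have "\<beta> (f a) \<in> linear_maps K W U"
    using assms by (auto simp: bilinear_map_def linear_mapsD)
  from linear_maps_comp[OF assms(3) this] show "(\<lambda>b. \<beta> (f a) (g b)) \<in> linear_maps K B U"
    by (simp add: comp_def)
next
  fix b assume "b \<in> carrier B"
  then have "(\<lambda>v. \<beta> v (g b)) \<in> linear_maps K V U"
    using assms by (auto simp: bilinear_map_def linear_mapsD)
  from linear_maps_comp[OF assms(2) this] show "(\<lambda>a. \<beta> (f a) (g b)) \<in> linear_maps K A U"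
    by (simp add: comp_def)
qed

context
  fixes K :: "('k, 'x) ring_scheme"
    and A :: "('k, 'a, 'p) module_scheme" and B :: "('k, 'b, 'q) module_scheme"
    and V :: "('k, 'v, 'y) module_scheme" and W :: "('k, 'w, 'z) module_scheme"
  assumes AB: "tensor_spaces K A B" and VW: "tensor_spaces K V W"
begin

interpretation AB: tensor_spaces K A B by (rule AB)
interpretation VW: tensor_spaces K V W by (rule VW)

lemma tensor_map_linear:
  assumes "f \<in> linear_maps K A V" "g \<in> linear_maps K B W"
  shows "tensor_map K V W f g \<in> linear_maps K (tensor_product K A B) (tensor_product K V W)"
  unfolding tensor_map_def
  by (rule AB.tensor_lift_linear[OF VW.VW.module_axioms
        bilinear_map_comp[OF VW.pure_tensor_bilinear assms]])

lemma tensor_map_pure: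
  assumes "f \<in> linear_maps K A V" "g \<in> linear_maps K B W" "a \<in> carrier A" "b \<in> carrier B"
  shows "tensor_map K V W f g (pure_tensor K A B a b) = pure_tensor K V W (f a) (g b)"
  unfolding tensor_map_def
  by (rule AB.tensor_lift_pure[OF VW.VW.module_axioms
        bilinear_map_comp[OF VW.pure_tensor_bilinear assms(1,2)] assms(3,4)])

end

text \<open>Both sides are linear in \<open>t\<close> and agree on pure tensors.\<close>

lemma tensor_map_comp:
  assumes AB: "tensor_spaces K A B" and VW: "tensor_spaces K V W" and XY: "tensor_spaces K X Y"
    and f: "f \<in> linear_maps K A V" and g: "g \<in> linear_maps K B W"
    and f': "f' \<in> linear_maps K V X" and g': "g' \<in> linear_maps K W Y"
    and t: "t \<in> carrier (tensor_product K A B)"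
  shows "tensor_map K X Y f' g' (tensor_map K V W f g t) = tensor_map K X Y (f' \<circ> f) (g' \<circ> g) t"
proof -
  interpret AB: tensor_spaces K A B by fact
  interpret XY: tensor_spaces K X Y by fact
  note f'f = linear_maps_comp[OF f f'] and g'g = linear_maps_comp[OF g g']
  have "(tensor_map K X Y f' g' \<circ> tensor_map K V W f g) t = tensor_map K X Y (f' \<circ> f) (g' \<circ> g) t"
    by (rule AB.tensor_linear_ext[OF XY.VW.module_axioms
          linear_maps_comp[OF tensor_map_linear[OF AB VW f g] tensor_map_linear[OF VW XY f' g']]
          tensor_map_linear[OF AB XY f'f g'g] _ t])
      (simp add: tensor_map_pure[OF AB VW f g] tensor_map_pure[OF VW XY f' g']
        tensor_map_pure[OF AB XY f'f g'g] linear_maps_closed[OF f] linear_maps_closed[OF g])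
  then show ?thesis by simp
qed


section \<open>Rota-Baxter paired comodules\<close>

context left_comodule
begin

lemma CM: "tensor_spaces K C M" ..

text \<open>The counit axiom exhibits a left inverse of \<open>\<rho>\<close>: apply
  \<open>\<epsilon>\<close> to the first factor, then \<open>tensor_lunit\<close>.\<close>

lemma coaction_inj: "inj_on \<rho> (carrier M)"
  by (metis coaction_counit inj_onI)

text \<open>Stated for one fixed \<open>P\<close>, with a right-hand side free of \<open>P\<close>:
  the Rota-Baxter identity therefore holds for all linear \<open>P\<close> or for none, which ties
  the generic condition to the existential one.\<close>

lemma rota_baxter_iff_quasi_idempotent:
  assumes lam: "lam \<in> carrier K" and T: "colinear K C M \<rho> T" and P: "P \<in> linear_maps K C C"
  shows "rota_baxter_paired_comodule K C \<Delta> \<epsilon> M \<rho> P T lam \<longleftrightarrow> quasi_idempotent K M T lam"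
proof -
  interpret CM: tensor_spaces K C M by (rule CM)
  let ?CM = "tensor_product K C M"
  interpret \<rho>: abelian_group_hom M ?CM \<rho>
    using linear_maps_abelian_group_hom[OF M.module_axioms CM.VW.module_axioms coaction_linear] .
  have Tl: "T \<in> linear_maps K M M"
    and colin: "\<And>m. m \<in> carrier M \<Longrightarrow> \<rho> (T m) = tensor_map K C M id T (\<rho> m)"
    using T by (auto simp: colinear_def)
  note Tc = linear_maps_closed[OF Tl]
  have "tensor_map K C M P T (\<rho> m) =
        tensor_map K C M P id (\<rho> (T m)) \<oplus>\<^bsub>?CM\<^esub> tensor_map K C M id T (\<rho> (T m)) \<oplus>\<^bsub>?CM\<^esub>
        lam \<odot>\<^bsub>?CM\<^esub> \<rho> (T m) \<longleftrightarrow> T (T m) = (\<ominus> lam) \<odot>\<^bsub>M\<^esub> T m" (is "?t = ?r \<longleftrightarrow> _")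
    if m: "m \<in> carrier M" for m
  proof -
    \<comment> \<open>The defect of quasi-idempotency at \<open>m\<close>; the Rota-Baxter identity
      will amount to its image under \<open>\<rho>\<close> being zero.\<close>
    let ?s = "T (T m) \<oplus>\<^bsub>M\<^esub> lam \<odot>\<^bsub>M\<^esub> T m"
    have s: "?s \<in> carrier M" using m lam by (simp add: Tc)
    have tc: "?t \<in> carrier ?CM"
      using m by (simp add: linear_maps_closed[OF tensor_map_linear[OF CM CM P Tl]])
    \<comment> \<open>Colinearity turns \<open>\<rho> (T m)\<close> into
      \<open>id \<otimes> T\<close> applied to \<open>\<rho> m\<close>; functoriality then merges
      this with \<open>P \<otimes> id\<close>.\<close>
    have "tensor_map K C M P id (\<rho> (T m)) = ?t"
      using m tensor_map_comp[OF CM CM CM linear_maps_id Tl P linear_maps_id, of "\<rho> m"]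
      by (simp add: colin)
    \<comment> \<open>Colinearity again, now at the element \<open>T m\<close>.\<close>
    moreover have "tensor_map K C M id T (\<rho> (T m)) = \<rho> (T (T m))"
      using m by (simp add: colin Tc)
    moreover have "lam \<odot>\<^bsub>?CM\<^esub> \<rho> (T m) = \<rho> (lam \<odot>\<^bsub>M\<^esub> T m)"
      using m lam by (simp add: linear_maps_smult[OF coaction_linear] Tc)
    ultimately have r: "?r = ?t \<oplus>\<^bsub>?CM\<^esub> \<rho> ?s"
      using m lam tc by (simp add: Tc CM.VW.M.a_assoc)
    \<comment> \<open>The common summand \<open>?t\<close>, the only place where \<open>P\<close>
      enters, cancels.\<close>
    have "?t = ?r \<longleftrightarrow> \<rho> ?s = \<zero>\<^bsub>?CM\<^esub>"
      unfolding r using tc s by (simp add: CM.VW.M.add.l_cancel_one')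
    also have "\<dots> \<longleftrightarrow> \<rho> ?s = \<rho> \<zero>\<^bsub>M\<^esub>" by simp
    also have "\<dots> \<longleftrightarrow> ?s = \<zero>\<^bsub>M\<^esub>"
      by (rule inj_on_eq_iff[OF coaction_inj s M.M.zero_closed])
    also have "\<dots> \<longleftrightarrow> T (T m) = (\<ominus> lam) \<odot>\<^bsub>M\<^esub> T m"
      using m lam
      by (metis M.M.minus_equality M.M.r_neg M.M.l_neg M.smult_closed M.smult_l_minus Tc)
    finally show ?thesis .
  qed
  then show ?thesis
    using lam P Tl left_comodule_axioms
    by (auto simp: rota_baxter_paired_comodule_def rota_baxter_paired_comodule_axioms_def
        quasi_idempotent_def)
qed

end

theorem theorem3p1:
  fixes K :: "('k, 'x) ring_scheme"
    and C :: "('k, 'c, 'y) module_scheme"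
    and M :: "('k, 'm, 'z) module_scheme"
  assumes "left_comodule K C \<Delta> \<epsilon> M \<rho>"
    and "lam \<in> carrier K"
    and "colinear K C M \<rho> T"
  shows "(generic_rota_baxter_paired_comodule K C \<Delta> \<epsilon> M \<rho> T lam \<longleftrightarrow>
          (\<exists>P. rota_baxter_paired_comodule K C \<Delta> \<epsilon> M \<rho> P T lam)) \<and>
         ((\<exists>P. rota_baxter_paired_comodule K C \<Delta> \<epsilon> M \<rho> P T lam) \<longleftrightarrow>
          quasi_idempotent K M T lam)"
proof -
  note iff = left_comodule.rota_baxter_iff_quasi_idempotent[OF assms]
  have "T \<in> linear_maps K M M" using assms(3) by (simp add: colinear_def)
  then have generic: "generic_rota_baxter_paired_comodule K C \<Delta> \<epsilon> M \<rho> T lam \<longleftrightarrow>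
      (\<forall>P\<in>linear_maps K C C. rota_baxter_paired_comodule K C \<Delta> \<epsilon> M \<rho> P T lam)"
    using assms(1) by (auto simp: generic_rota_baxter_paired_comodule_def
        generic_rota_baxter_paired_comodule_axioms_def)
  \<comment> \<open>The existential in (2) ranges over all functions; linearity of a witness is
    recovered from the locale, so that \<open>iff\<close> applies to it.\<close>
  have P: "P \<in> linear_maps K C C" if "rota_baxter_paired_comodule K C \<Delta> \<epsilon> M \<rho> P T lam" for P
    using that by (rule rota_baxter_paired_comodule.P_linear)
  show ?thesis
    \<comment> \<open>Passing from all linear \<open>P\<close> to some \<open>P\<close> requires one
      linear operator on \<open>C\<close>; \<open>id\<close> provides it.\<close>
    unfolding generic using P iff linear_maps_id[of K C] by blast
qed

end
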